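(* Let $k \in \mathbb{Z}_{>0}$ and $R \in \mathbb{Z}_{\geq 5}$. There is no Fano polygon with singularity content $\left(0, \left\{ k \times \frac{1}{R}(1,1) \right\}\right)$, i.e. with first entry $0$ and with basket of residual singularities consisting of exactly $k$ copies of $\frac{1}{R}(1,1)$.
   Context: Let $N \cong \mathbb{Z}^2$ and $N_{\mathbb{R}} = N \otimes \mathbb{R}$. A Fano polygon $P \subset N_{\mathbb{R}}$ is a full-dimensional (two-dimensional) convex lattice polygon whose vertices are all primitive lattice vectors and which contains the origin in its strict interior. Cyclic quotient singularities: for a positive integer $R$ and integers $a,b$ with $\gcd(R,a)=\gcd(R,b)=1$, $\frac{1}{R}(a,b)$ denotes the germ at the origin of the quotient of $\mathbb{C}^2$ by the cyclic group $\mu_R$ acting by $(x,y)\mapsto(\epsilon^a x,\epsilon^b y)$, $\epsilon$ a primitive $R$-th root of unity. Combinatorially it corresponds to the cone $\mathrm{cone}(e_1,e_2)$ in the lattice $\mathbb{Z}^2 + (a/R,b/R)\cdot\mathbb{Z}$. A two-dimensional rational cone $C \subset N_{\mathbb{R}}$ is identified with the singularity $\frac{1}{R}(a,b)$ if there is a lattice isomorphism taking $C$ to this cone (with $R=1$ for a smooth cone). Singularities are considered up to isomorphism. Singularity content of a cone: any cyclic quotient singularity $\sigma=\frac{1}{R}(a,b)$ can be written as $\frac{1}{kr}(1,kc-1)$ with $k=\gcd(a+b,R)$, $R=kr$, and some integer $c$ (here $k$ is unrelated to the number of copies in the claim). Let $n,k_0$ be the unique non-negative integers with $k=nr+k_0$,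 $0\le k_0<r$. The residue is $\mathrm{res}(\sigma)=\varnothing$ if $k_0=0$, and $\mathrm{res}(\sigma)=\frac{1}{k_0 r}(1,k_0c-1)$ otherwise. The singularity content of $\sigma$ is $\mathrm{SC}(\sigma)=(n,\mathrm{res}(\sigma))$. Singularity content of a polygon: let $E_1,\dots,E_m$ be the edges of the Fano polygon $P$ in clockwise order, let $\sigma_i$ be the singularity corresponding to the cone over $E_i$ (with apex the origin), and write $\mathrm{SC}(\sigma_i)=(n_i,\mathrm{res}(\sigma_i))$. The singularity content of $P$ is $\mathrm{SC}(P)=\left(\sum_{i=1}^m n_i,\mathcal{B}\right)$, where the basket of residual singularities $\mathcal{B}=\{\mathrm{res}(\sigma_1),\dots,\mathrm{res}(\sigma_m)\}$ is a cyclically ordered collection (counted with multiplicity, empty residues omitted). *)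

theory Defs
  imports "HOL-Analysis.Analysis"
begin

text \<open>Coordinates are fixed once and for all: \<open>N\<close> is the integer lattice inside
  \<open>N\<^sub>\<real> = \<real> \<times> \<real>\<close>.\<close>

definition int_lattice :: "(real \<times> real) set" where
  "int_lattice = {(of_int x, of_int y) | x y :: int. True}"

definition primitive :: "real \<times> real \<Rightarrow> bool" where
  "primitive v \<longleftrightarrow> (\<exists>x y :: int. coprime x y \<and> v = (of_int x, of_int y))"

definition fano_polygon :: "(real \<times> real) set \<Rightarrow> bool" where
  "fano_polygon P \<longleftrightarrow>
     polytope P \<and> aff_dim P = 2 \<and>
     (\<forall>v. v extreme_point_of P \<longrightarrow> primitive v) \<and>
     0 \<in> interior P"


text \<open>A cone \<open>C\<close> is always considered together with a lattice \<open>L\<close>.\<close>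

definition lattice_cone_iso ::
  "(real \<times> real) set \<Rightarrow> (real \<times> real) set \<Rightarrow> (real \<times> real) set \<Rightarrow> (real \<times> real) set \<Rightarrow> bool" where
  "lattice_cone_iso L C L' C' \<longleftrightarrow> (\<exists>f. linear f \<and> bij f \<and> f ` L = L' \<and> f ` C = C')"

definition quadrant :: "(real \<times> real) set" where
  "quadrant = {(s, t). 0 \<le> s \<and> 0 \<le> t}"

definition quotient_symbol :: "int \<Rightarrow> int \<Rightarrow> int \<Rightarrow> bool" where
  "quotient_symbol R a b \<longleftrightarrow> R > 0 \<and> coprime R a \<and> coprime R b"

definition quotient_lattice :: "int \<Rightarrow> int \<Rightarrow> int \<Rightarrow> (real \<times> real) set" where
  "quotient_lattice R a b =
     {u + of_int m *\<^sub>R (of_int a / of_int R, of_int b / of_int R) | u m. u \<in> int_lattice}"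

text \<open>An isomorphism class of cyclic quotient singularities is represented by the set of all
  triples \<open>(R, a, b)\<close> such that \<open>1/R(a, b)\<close> belongs to the class.\<close>

type_synonym singularity = "(int \<times> int \<times> int) set"

definition singularity_of :: "(real \<times> real) set \<Rightarrow> (real \<times> real) set \<Rightarrow> singularity" where
  "singularity_of L C =
     {(R, a, b). quotient_symbol R a b \<and> lattice_cone_iso L C (quotient_lattice R a b) quadrant}"

definition cone_singularity :: "(real \<times> real) set \<Rightarrow> singularity" where
  "cone_singularity C = singularity_of int_lattice C"

definition quotient_singularity :: "int \<Rightarrow> int \<Rightarrow> int \<Rightarrow> singularity" where
  "quotient_singularity R a b = singularity_of (quotient_lattice R a b) quadrant"


text \<open>\<open>has_SC \<sigma> (n, \<rho>)\<close> says \<open>SC(\<sigma>) = (n, \<rho>)\<close>, as a relation because the definition chooses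
  \<open>a\<close>, \<open>b\<close> and \<open>c\<close>; \<open>None\<close> is the empty residue. The numbers \<open>n\<close> and \<open>k\<^sub>0\<close> with
  \<open>k = n r + k\<^sub>0\<close>, \<open>0 \<le> k\<^sub>0 < r\<close> are \<open>k div r\<close> and \<open>k mod r\<close>.\<close>

definition has_SC :: "singularity \<Rightarrow> nat \<times> singularity option \<Rightarrow> bool" where
  "has_SC \<sigma> s \<longleftrightarrow>
     (\<exists>R a b k r c.
        quotient_symbol R a b \<and> \<sigma> = quotient_singularity R a b \<and>
        k = gcd (a + b) R \<and> R = k * r \<and>
        quotient_symbol (k * r) 1 (k * c - 1) \<and>
        \<sigma> = quotient_singularity (k * r) 1 (k * c - 1) \<and>
        s = (nat (k div r),
             if k mod r = 0 then None
             else Some (quotient_singularity ((k mod r) * r) 1 ((k mod r) * c - 1))))"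

definition det2 :: "real \<times> real \<Rightarrow> real \<times> real \<Rightarrow> real" where
  "det2 v w = fst v * snd w - snd v * fst w"

text \<open>For a polygon with the origin in its interior, the boundary is traversed clockwise iff
  consecutive vertices \<open>v\<close>, \<open>w\<close> satisfy \<open>det2 v w < 0\<close>.\<close>

definition clockwise_edges :: "(real \<times> real) set \<Rightarrow> (real \<times> real) set list \<Rightarrow> bool" where
  "clockwise_edges P Es \<longleftrightarrow>
     distinct Es \<and> set Es = {E. E edge_of P} \<and>
     (\<exists>vs. length vs = length Es \<and>
        (\<forall>i < length Es.
           Es ! i = closed_segment (vs ! i) (vs ! (Suc i mod length vs)) \<and>
           det2 (vs ! i) (vs ! (Suc i mod length vs)) < 0))"

text \<open>A cyclically ordered collection is the set of all rotations of a list.\<close>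

definition cyclic :: "'a list \<Rightarrow> 'a list set" where
  "cyclic xs = {rotate j xs | j. True}"

definition has_polygon_SC :: "(real \<times> real) set \<Rightarrow> nat \<times> singularity list set \<Rightarrow> bool" where
  "has_polygon_SC P S \<longleftrightarrow>
     (\<exists>Es ss. clockwise_edges P Es \<and>
        list_all2 (\<lambda>E s. has_SC (cone_singularity (cone hull E)) s) Es ss \<and>
        S = (\<Sum>s\<leftarrow>ss. fst s, cyclic (List.map_filter snd ss)))"

end

theory Submission
  imports Defs
begin

text \<open>Every edge has first entry \<open>0\<close>, so its cone equals its own residue, and all the cones are
  \<open>1/R(1,1)\<close>. Hence consecutive vertices satisfy \<open>v + w = R u\<close> with \<open>u\<close> a lattice point and
  \<open>det(v, w) = -R\<close>. For consecutive vertices \<open>v\<^sub>0, v\<^sub>1, v\<^sub>2\<close> this gives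
  \<open>v\<^sub>0 + v\<^sub>2 = (R a - 2) v\<^sub>1\<close> with \<open>a\<close> an integer, and convexity at \<open>v\<^sub>1\<close> forces \<open>R a \<le> 4\<close>,
  that is \<open>a \<le> 0\<close> as \<open>R \<ge> 5\<close>. So \<open>v\<^sub>0 + v\<^sub>2 = b v\<^sub>1\<close> and \<open>v\<^sub>1 + v\<^sub>3 = b' v\<^sub>2\<close> with \<open>b, b' \<le> -2\<close>;
  the linear form equal to \<open>1\<close> on the edge \<open>[v\<^sub>0, v\<^sub>1]\<close> then takes the value
  \<open>b' (b - 1) - 1 \<ge> 5\<close> at \<open>v\<^sub>3\<close>, although it is at most \<open>1\<close> on the polygon.\<close>

section \<open>Planar determinants, lattice points and primitive vectors\<close>

lemma det2_scaled_add_left: "det2 (p *\<^sub>R v + q *\<^sub>R w) z = p * det2 v z + q * det2 w z"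
  by (simp add: det2_def algebra_simps)

lemma det2_scaled_add_right: "det2 z (p *\<^sub>R v + q *\<^sub>R w) = p * det2 z v + q * det2 z w"
  by (simp add: det2_def algebra_simps)

lemma det2_commute: "det2 v w = - det2 w v"
  by (simp add: det2_def)

lemma det2_self [simp]: "det2 v v = 0"
  by (simp add: det2_def)

lemma det2_eq_zeroE:
  assumes "det2 v w = 0" "w \<noteq> 0"
  obtains c where "v = c *\<^sub>R w"
proof (cases "fst w = 0")
  case True
  then have "snd w \<noteq> 0" using assms(2) by (simp add: prod_eq_iff)
  then have "v = (snd v / snd w) *\<^sub>R w"
    using assms(1) True by (auto simp: det2_def prod_eq_iff)
  then show ?thesis by (rule that)
next
  case False
  then have "v = (fst v / fst w) *\<^sub>R w"
    using assms(1) by (auto simp: det2_def prod_eq_iff field_simps)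
  then show ?thesis by (rule that)
qed

lemma det2_nonzero_zero_notin_segment:
  assumes "det2 v w \<noteq> 0"
  shows "0 \<notin> closed_segment v w"
proof
  assume "0 \<in> closed_segment v w"
  then obtain t where t: "0 = (1 - t) *\<^sub>R v + t *\<^sub>R w" by (auto simp: closed_segment_def)
  have "t * det2 v w = det2 v ((1 - t) *\<^sub>R v + t *\<^sub>R w)"
       "(1 - t) * det2 v w = det2 ((1 - t) *\<^sub>R v + t *\<^sub>R w) w"
    by (simp_all add: det2_scaled_add_left det2_scaled_add_right)
  then have "t * det2 v w = 0" "(1 - t) * det2 v w = 0"
    by (simp_all add: t[symmetric] det2_def)
  with assms show False by simp
qed

lemma int_lattice_iff: "v \<in> int_lattice \<longleftrightarrow> fst v \<in> \<int> \<and> snd v \<in> \<int>"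
  by (cases v) (auto simp: int_lattice_def Ints_def)

lemma int_lattice_add: "u \<in> int_lattice \<Longrightarrow> v \<in> int_lattice \<Longrightarrow> u + v \<in> int_lattice"
  by (simp add: int_lattice_iff)

lemma det2_int_lattice: "u \<in> int_lattice \<Longrightarrow> v \<in> int_lattice \<Longrightarrow> det2 u v \<in> \<int>"
  by (simp add: int_lattice_iff det2_def)

lemma primitive_in_int_lattice: "primitive v \<Longrightarrow> v \<in> int_lattice"
  by (auto simp: primitive_def int_lattice_def)

lemma primitive_nonzero: "primitive v \<Longrightarrow> v \<noteq> 0"
  by (auto simp: primitive_def prod_eq_iff)

text \<open>By Bezout, \<open>c\<close> is an integer combination of the two coordinates of
  \<open>c *\<^sub>R v\<close>.\<close>

lemma primitive_multiple_in_lattice: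
  assumes "primitive v" "c *\<^sub>R v \<in> int_lattice"
  shows "c \<in> \<int>"
proof -
  obtain x y :: int where xy: "coprime x y" "v = (of_int x, of_int y)"
    using assms(1) by (auto simp: primitive_def)
  obtain p q where "p * x + q * y = 1"
    using xy(1) bezout_int[of x y] by auto
  then have "c * of_int (p * x + q * y) = c" by simp
  then have "c = of_int p * (c * of_int x) + of_int q * (c * of_int y)"
    by (simp add: algebra_simps)
  moreover have "c * of_int x \<in> \<int>" "c * of_int y \<in> \<int>"
    using assms(2) xy(2) by (auto simp: int_lattice_iff)
  ultimately show ?thesis by (metis Ints_add Ints_mult Ints_of_int)
qed

section \<open>Cones isomorphic to the cone of \<open>1/R(1,1)\<close>\<close>

lemma quotient_lattice_11_iff:
  "z \<in> quotient_lattice R 1 1 \<longleftrightarrow>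
     (\<exists>x y m :: int. z = (of_int x + of_int m / of_int R, of_int y + of_int m / of_int R))"
proof -
  have "z \<in> quotient_lattice R 1 1 \<longleftrightarrow>
      (\<exists>m x y. z = (of_int x, of_int y) + of_int m *\<^sub>R (of_int 1 / of_int R, of_int 1 / of_int R))"
    unfolding quotient_lattice_def int_lattice_def by blast
  then show ?thesis by simp metis
qed

text \<open>The fractional part \<open>m/R\<close> cancels in the difference of the coordinates of
  \<open>f v\<close>, so \<open>s\<close> is an integer. The vector \<open>e\<close> also lies in
  the quotient lattice, so its preimage \<open>v/s\<close> is a lattice point and primitivity makes
  \<open>1/s\<close> an integer. As \<open>s\<close> is positive, it is \<open>1\<close>.\<close>

lemma primitive_axis_image:
  assumes "linear f" "inj f" and L: "f ` int_lattice = quotient_lattice R 1 1"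
    and "R > 0" "primitive v" and e: "e = (1, 0) \<or> e = (0, 1)"
    and fv: "f v = s *\<^sub>R e" and "s > 0"
  shows "f v = e"
proof -
  have "f v \<in> quotient_lattice R 1 1"
    using primitive_in_int_lattice[OF assms(5)] L by blast
  then obtain x y m :: int where
    "s *\<^sub>R e = (of_int x + of_int m / of_int R, of_int y + of_int m / of_int R)"
    unfolding fv quotient_lattice_11_iff by blast
  then have "s = of_int x - of_int y \<or> s = of_int y - of_int x"
    using e by auto
  then have sZ: "s \<in> \<int>" by auto
  have "e = (of_int 1 + of_int 0 / of_int R, of_int 0 + of_int 0 / of_int R) \<or>
      e = (of_int 0 + of_int 0 / of_int R, of_int 1 + of_int 0 / of_int R)"
    using e by simp
  then have "e \<in> quotient_lattice R 1 1"
    unfolding quotient_lattice_11_iff by blast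
  then obtain z where z: "z \<in> int_lattice" "f z = e" using L by (metis imageE)
  have "f ((1 / s) *\<^sub>R v) = f z"
    using \<open>s > 0\<close> by (simp add: linear_cmul[OF assms(1)] fv z)
  then have "(1 / s) *\<^sub>R v = z" using assms(2) by (simp add: inj_eq)
  then have "1 / s \<in> \<int>" using primitive_multiple_in_lattice[OF assms(5)] z(1) by metis
  then have "\<bar>1 / s\<bar> \<ge> 1" "\<bar>s\<bar> \<ge> 1"
    using sZ \<open>s > 0\<close> by (auto dest!: Ints_nonzero_abs_ge1)
  then have "s = 1" using \<open>s > 0\<close> by (simp add: field_simps)
  then show ?thesis by (simp add: fv)
qed

text \<open>The witness \<open>u\<close> is the preimage of \<open>(1/R, 1/R)\<close>. Together with
  \<open>v\<close> it generates the lattice, so \<open>det2 v u\<close> is a unit; then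
  \<open>w = R u - v\<close> gives the determinant of \<open>v\<close> and \<open>w\<close>.\<close>

lemma standard_cone_edge:
  assumes "linear f" "inj f" and L: "f ` int_lattice = quotient_lattice R 1 1"
    and "R > 0" "primitive v" "primitive w"
    and fv: "f v = (1, 0)" and fw: "f w = (0, 1)"
  shows "\<exists>u \<in> int_lattice. v + w = of_int R *\<^sub>R u \<and> \<bar>det2 v w\<bar> = of_int R"
proof -
  have "(1 / of_int R, 1 / of_int R) =
      (of_int 0 + of_int 1 / of_int R, of_int 0 + of_int 1 / of_int R :: real)"
    by simp
  then have "(1 / of_int R, 1 / of_int R) \<in> quotient_lattice R 1 1"
    unfolding quotient_lattice_11_iff by blast
  then obtain u where u: "u \<in> int_lattice" "f u = (1 / of_int R, 1 / of_int R)"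
    using L by (metis imageE)
  have "f (of_int R *\<^sub>R u) = f (v + w)"
    using \<open>R > 0\<close> by (simp add: linear_cmul[OF assms(1)] linear_add[OF assms(1)] u fv fw)
  then have uvw: "v + w = of_int R *\<^sub>R u" using assms(2) by (simp add: inj_eq)
  have w_eq: "w = of_int R *\<^sub>R u + (-1) *\<^sub>R v"
    unfolding uvw[symmetric] by simp
  have basis: "\<exists>p q :: int. z = of_int p *\<^sub>R v + of_int q *\<^sub>R u" if "z \<in> int_lattice" for z
  proof -
    have "f z \<in> quotient_lattice R 1 1" using that L by blast
    then obtain x y m :: int where
      fz: "f z = (of_int x + of_int m / of_int R, of_int y + of_int m / of_int R)"
      unfolding quotient_lattice_11_iff by blast
    have "f z = f (of_int x *\<^sub>R v + of_int y *\<^sub>R w + of_int m *\<^sub>R u)"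
      by (simp add: linear_cmul[OF assms(1)] linear_add[OF assms(1)] u fv fw fz)
    then have "z = of_int x *\<^sub>R v + of_int y *\<^sub>R w + of_int m *\<^sub>R u"
      using assms(2) by (simp add: inj_eq)
    also have "\<dots> = of_int (x - y) *\<^sub>R v + of_int (y * R + m) *\<^sub>R u"
      unfolding w_eq by (simp add: algebra_simps)
    finally show ?thesis by blast
  qed
  \<comment> \<open>Expanding the standard basis in \<open>v\<close> and \<open>u\<close> writes its
    determinant \<open>1\<close> as an integer multiple of \<open>d\<close>, hence \<open>d\<close>
    is \<open>1\<close> or \<open>-1\<close>.\<close>
  obtain p q where pq: "(1, 0) = of_int p *\<^sub>R v + of_int q *\<^sub>R u"
    using basis[of "(1, 0)"] by (auto simp: int_lattice_iff)
  obtain p' q' where pq': "(0, 1) = of_int p' *\<^sub>R v + of_int q' *\<^sub>R u"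
    using basis[of "(0, 1)"] by (auto simp: int_lattice_iff)
  obtain d :: int where d: "det2 v u = of_int d"
    using det2_int_lattice[OF primitive_in_int_lattice[OF assms(5)] u(1)] by (auto elim: Ints_cases)
  have "1 = det2 (1, 0) (0, 1)" by (simp add: det2_def)
  also have "\<dots> = of_int ((p * q' - q * p') * d)"
    unfolding pq pq' det2_scaled_add_left det2_scaled_add_right
    by (simp add: d det2_commute[of u v] algebra_simps)
  finally have "(p * q' - q * p') * d = 1" by linarith
  then have "\<bar>d\<bar> = 1" by (metis abs_zmult_eq_1 mult.commute abs_1)
  moreover have "det2 v w = of_int (R * d)"
    unfolding w_eq det2_scaled_add_right by (simp add: d)
  ultimately have "\<bar>det2 v w\<bar> = of_int R"
    using \<open>R > 0\<close> by (simp add: abs_mult flip: of_int_abs)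
  with u(1) uvw show ?thesis by blast
qed

text \<open>The isomorphism must send the two generators to the two axes, in either order.
  Primitivity then fixes their lengths, and the symmetry of \<open>1/R(1,1)\<close> makes both
  orders lead to the same conclusion.\<close>

lemma cone_iso_11_edge:
  assumes "lattice_cone_iso int_lattice (cone hull closed_segment v w) (quotient_lattice R 1 1) quadrant"
    and "R > 0" "primitive v" "primitive w"
  shows "\<exists>u \<in> int_lattice. v + w = of_int R *\<^sub>R u \<and> \<bar>det2 v w\<bar> = of_int R"
proof -
  obtain f where f: "linear f" "inj f" and L: "f ` int_lattice = quotient_lattice R 1 1"
    and C: "f ` (cone hull closed_segment v w) = quadrant"
    using assms(1) unfolding lattice_cone_iso_def bij_def by blast
  have "v \<in> cone hull closed_segment v w" "w \<in> cone hull closed_segment v w"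
    by (simp_all add: hull_inc)
  then have quad: "f v \<in> quadrant" "f w \<in> quadrant"
    unfolding C[symmetric] by blast+
  have nz: "f v \<noteq> 0" "f w \<noteq> 0"
    using f assms(3,4) primitive_nonzero by (metis inj_eq linear_0)+
  have comb: "\<exists>\<alpha> \<beta>. \<alpha> \<ge> 0 \<and> \<beta> \<ge> 0 \<and> e = \<alpha> *\<^sub>R f v + \<beta> *\<^sub>R f w" if e: "e \<in> quadrant" for e
  proof -
    obtain x where x: "x \<in> cone hull closed_segment v w" "e = f x"
      using e unfolding C[symmetric] by blast
    then obtain c t where ct: "c \<ge> 0" "0 \<le> t" "t \<le> 1" "x = c *\<^sub>R ((1 - t) *\<^sub>R v + t *\<^sub>R w)"
      unfolding cone_hull_expl closed_segment_def by (elim CollectE exE conjE) simp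
    then have "e = (c * (1 - t)) *\<^sub>R f v + (c * t) *\<^sub>R f w"
      by (simp add: x(2) linear_cmul[OF f(1)] linear_add[OF f(1)] scaleR_add_right)
    then show ?thesis using ct by (metis diff_ge_0_iff_ge mult_nonneg_nonneg)
  qed
  \<comment> \<open>In a nonnegative combination equal to \<open>(1, 0)\<close>, both terms have
    second coordinate 0, while some coefficient is nonzero.\<close>
  have "snd (f v) = 0 \<or> snd (f w) = 0"
  proof -
    have "(1, 0) \<in> quadrant" by (simp add: quadrant_def)
    from comb[OF this] obtain \<alpha> \<beta>
      where "\<alpha> \<ge> 0" "\<beta> \<ge> 0" and e: "(1, 0) = \<alpha> *\<^sub>R f v + \<beta> *\<^sub>R f w"
      by blast
    then have "\<alpha> * snd (f v) = 0" "\<beta> * snd (f w) = 0"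
      using quad arg_cong[OF e, of snd]
      by (auto simp: quadrant_def add_nonneg_eq_0_iff split: prod.splits)
    then show ?thesis using arg_cong[OF e, of fst] by auto
  qed
  moreover have "fst (f v) = 0 \<or> fst (f w) = 0"
  proof -
    have "(0, 1) \<in> quadrant" by (simp add: quadrant_def)
    from comb[OF this] obtain \<alpha> \<beta>
      where "\<alpha> \<ge> 0" "\<beta> \<ge> 0" and e: "(0, 1) = \<alpha> *\<^sub>R f v + \<beta> *\<^sub>R f w"
      by blast
    then have "\<alpha> * fst (f v) = 0" "\<beta> * fst (f w) = 0"
      using quad arg_cong[OF e, of fst]
      by (auto simp: quadrant_def add_nonneg_eq_0_iff split: prod.splits)
    then show ?thesis using arg_cong[OF e, of snd] by auto
  qed
  ultimately consider "snd (f v) = 0" "fst (f w) = 0" | "fst (f v) = 0" "snd (f w) = 0"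
    using nz by (auto simp: prod_eq_iff)
  then show ?thesis
  proof cases
    case 1
    have "f v = (1, 0)"
      by (rule primitive_axis_image[OF f L assms(2,3), where s = "fst (f v)"])
        (use 1 nz quad in \<open>auto simp: prod_eq_iff quadrant_def split: prod.splits\<close>)
    moreover have "f w = (0, 1)"
      by (rule primitive_axis_image[OF f L assms(2,4), where s = "snd (f w)"])
        (use 1 nz quad in \<open>auto simp: prod_eq_iff quadrant_def split: prod.splits\<close>)
    ultimately show ?thesis using standard_cone_edge[OF f L assms(2-4)] by blast
  next
    case 2
    have "f v = (0, 1)"
      by (rule primitive_axis_image[OF f L assms(2,3), where s = "snd (f v)"])
        (use 2 nz quad in \<open>auto simp: prod_eq_iff quadrant_def split: prod.splits\<close>)
    moreover have "f w = (1, 0)"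
      by (rule primitive_axis_image[OF f L assms(2,4), where s = "fst (f w)"])
        (use 2 nz quad in \<open>auto simp: prod_eq_iff quadrant_def split: prod.splits\<close>)
    ultimately show ?thesis
      using standard_cone_edge[OF f L assms(2) assms(4) assms(3)]
      by (simp add: add.commute det2_commute[of w v])
  qed
qed

section \<open>Singularity content and the geometry of consecutive edges\<close>

text \<open>A vanishing first entry means \<open>0 < k < r\<close>, so \<open>k mod r = k\<close>
  and the residue formula returns the singularity itself, never the empty residue.\<close>

lemma has_SC_zero:
  assumes "has_SC \<sigma> s" "fst s = 0"
  shows "snd s = Some \<sigma>"
proof -
  obtain R a b k r c where *: "quotient_symbol R a b" "k = gcd (a + b) R" "R = k * r"
    "\<sigma> = quotient_singularity (k * r) 1 (k * c - 1)"
    "s = (nat (k div r), if k mod r = 0 then None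
             else Some (quotient_singularity ((k mod r) * r) 1 ((k mod r) * c - 1)))"
    using assms(1) unfolding has_SC_def by blast
  have "R > 0" using *(1) by (simp add: quotient_symbol_def)
  then have "k > 0" using *(2) by simp
  with \<open>R > 0\<close> *(3) have "r > 0" by (simp add: zero_less_mult_iff)
  have "k div r \<le> 0" using assms(2) *(5) by simp
  with \<open>k > 0\<close> \<open>r > 0\<close> have "k < r"
    using pos_imp_zdiv_pos_iff[of r k] by linarith
  with \<open>k > 0\<close> have "k mod r = k" by simp
  with *(4,5) \<open>k > 0\<close> show ?thesis by simp
qed

lemma lattice_cone_iso_refl: "lattice_cone_iso L C L C"
  unfolding lattice_cone_iso_def by (rule exI[of _ id]) (simp add: linear_id)

text \<open>Faces of a polytope are exposed, and the edge misses the origin because its endpoints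
  are independent. The supporting line therefore has a positive right-hand side, which can be scaled
  to 1.\<close>

lemma edge_supporting_form:
  assumes P: "polytope P" "0 \<in> P" and E: "closed_segment v w edge_of P" "det2 v w \<noteq> 0"
  obtains n where "n \<bullet> v = 1" "n \<bullet> w = 1" "\<And>x. x \<in> P \<Longrightarrow> n \<bullet> x \<le> 1"
proof -
  have "closed_segment v w face_of P" using E(1) by (simp add: edge_of_def)
  then have "closed_segment v w exposed_face_of P"
    using P(1) exposed_face_of_polyhedron polytope_imp_polyhedron by blast
  then obtain a b where ab: "P \<subseteq> {x. a \<bullet> x \<le> b}" "closed_segment v w = P \<inter> {x. a \<bullet> x = b}"
    unfolding exposed_face_of_def by blast
  have "b \<ge> 0" using ab(1) P(2) by force
  moreover have "b \<noteq> 0"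
    using det2_nonzero_zero_notin_segment[OF E(2)] ab(2) P(2) by auto
  ultimately have "b > 0" by simp
  have "a \<bullet> v = b" "a \<bullet> w = b" using ab(2) by auto
  then show ?thesis
    using \<open>b > 0\<close> ab(1) by (intro that[of "(1 / b) *\<^sub>R a"]) (auto simp: field_simps)
qed

text \<open>Equality of the determinants makes \<open>u + u'\<close> parallel to \<open>v\<close>,
  and primitivity of \<open>v\<close> makes the factor an integer \<open>a\<close>. The
  \<open>-2\<close> comes from \<open>v\<close> occurring in both edge sums.\<close>

lemma consecutive_vertices:
  fixes R :: int
  assumes "R > 0" "primitive v" "u \<in> int_lattice" "u' \<in> int_lattice"
    and "v' + v = of_int R *\<^sub>R u" "v + v'' = of_int R *\<^sub>R u'" "det2 v' v = det2 v v''"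
  obtains a :: int where "v'' = (of_int (R * a) - 2) *\<^sub>R v - v'"
proof -
  have uu: "of_int R *\<^sub>R (u + u') = v' + v'' + 2 *\<^sub>R v"
    unfolding scaleR_add_right assms(5,6)[symmetric] by (simp add: scaleR_2)
  have "of_int R * det2 (u + u') v = det2 (of_int R *\<^sub>R (u + u')) v"
    by (simp add: det2_def algebra_simps)
  also have "\<dots> = det2 v' v - det2 v v''"
    unfolding uu by (simp add: det2_def algebra_simps)
  finally have "det2 (u + u') v = 0" using assms(1,7) by simp
  then obtain c where c: "u + u' = c *\<^sub>R v"
    using primitive_nonzero[OF assms(2)] by (rule det2_eq_zeroE)
  then have "c \<in> \<int>"
    using primitive_multiple_in_lattice[OF assms(2)] int_lattice_add[OF assms(3,4)] by simp
  then obtain a where "c = of_int a" by (auto elim: Ints_cases)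
  with uu c have "v'' = (of_int (R * a) - 2) *\<^sub>R v - v'"
    by (simp add: algebra_simps)
  then show ?thesis by (rule that)
qed

text \<open>All first entries are natural numbers with sum 0, so each edge puts its own singularity
  into the basket; the basket is a rotation of copies of \<open>1/R(1,1)\<close>, which fixes the
  type of every edge.\<close>

lemma polygon_edges_11:
  assumes "has_polygon_SC P (0, cyclic (replicate k (quotient_singularity R 1 1)))"
    and "k > 0" "R > 0"
  obtains vs where "vs \<noteq> []"
    and "\<And>i. i < length vs \<Longrightarrow>
      closed_segment (vs ! i) (vs ! (Suc i mod length vs)) edge_of P \<and>
      det2 (vs ! i) (vs ! (Suc i mod length vs)) < 0 \<and>
      lattice_cone_iso int_lattice (cone hull closed_segment (vs ! i) (vs ! (Suc i mod length vs)))
        (quotient_lattice R 1 1) quadrant"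
proof -
  let ?Q = "quotient_singularity R 1 1"
  obtain Es ss where Es: "clockwise_edges P Es"
    and all: "list_all2 (\<lambda>E s. has_SC (cone_singularity (cone hull E)) s) Es ss"
    and n: "(\<Sum>s\<leftarrow>ss. fst s) = 0"
    and cyc: "cyclic (replicate k ?Q) = cyclic (List.map_filter snd ss)"
    using assms(1) unfolding has_polygon_SC_def by auto
  have "List.map_filter snd ss \<in> cyclic (List.map_filter snd ss)"
    unfolding cyclic_def by (intro CollectI exI[of _ 0]) simp
  then obtain j where j: "List.map_filter snd ss = rotate j (replicate k ?Q)"
    unfolding cyc[symmetric] unfolding cyclic_def by blast
  have sing: "cone_singularity (cone hull E) = ?Q" if E: "E \<in> set Es" for E
  proof -
    obtain i where i: "i < length Es" "Es ! i = E" using E unfolding in_set_conv_nth by blast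
    then have s: "has_SC (cone_singularity (cone hull E)) (ss ! i)" "ss ! i \<in> set ss"
      using list_all2_nthD[OF all i(1)] list_all2_lengthD[OF all] by simp_all
    then have "fst (ss ! i) = 0" using n by auto
    with s have "snd (ss ! i) = Some (cone_singularity (cone hull E))" by (simp add: has_SC_zero)
    with s(2) have "cone_singularity (cone hull E) \<in> set (List.map_filter snd ss)"
      by (force simp: map_filter_def)
    then show ?thesis using j by (simp split: if_splits)
  qed
  \<comment> \<open>Since \<open>k > 0\<close>, the basket is nonempty, so there is at least one
    edge.\<close>
  have "ss \<noteq> []"
    using arg_cong[OF j, of length] assms(2) by (auto simp: map_filter_def)
  then have ne: "Es \<noteq> []" using all by auto
  obtain vs where vs: "length vs = length Es"
    "\<And>i. i < length Es \<Longrightarrow> Es ! i = closed_segment (vs ! i) (vs ! (Suc i mod length vs)) \<and>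
           det2 (vs ! i) (vs ! (Suc i mod length vs)) < 0"
    and edges: "set Es = {E. E edge_of P}"
    using Es unfolding clockwise_edges_def by blast
  \<comment> \<open>Equal classes share this symbol, which turns equality of singularities into an
    explicit cone isomorphism for each edge.\<close>
  have mem: "(R, 1, 1) \<in> ?Q"
    using assms(3) by (simp add: quotient_singularity_def singularity_of_def quotient_symbol_def
      lattice_cone_iso_refl)
  show ?thesis
  proof (rule that)
    show "vs \<noteq> []" using ne vs(1) by auto
    fix i assume "i < length vs"
    then have i: "i < length Es" using vs(1) by simp
    then have "Es ! i \<in> set Es" by simp
    then have "Es ! i edge_of P" "(R, 1, 1) \<in> cone_singularity (cone hull (Es ! i))"
      using edges sing mem by auto
    then show "closed_segment (vs ! i) (vs ! (Suc i mod length vs)) edge_of P \<and>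
      det2 (vs ! i) (vs ! (Suc i mod length vs)) < 0 \<and>
      lattice_cone_iso int_lattice (cone hull closed_segment (vs ! i) (vs ! (Suc i mod length vs)))
        (quotient_lattice R 1 1) quadrant"
      using vs(2)[OF i] by (auto simp: cone_singularity_def singularity_of_def)
  qed
qed

theorem theorem1p7:
  fixes k :: nat and R :: int
  assumes "k > 0" and "R \<ge> 5"
  shows "\<not> (\<exists>P. fano_polygon P \<and>
            has_polygon_SC P (0, cyclic (replicate k (quotient_singularity R 1 1))))"
proof
  assume "\<exists>P. fano_polygon P \<and>
    has_polygon_SC P (0, cyclic (replicate k (quotient_singularity R 1 1)))"
  then obtain P where P: "fano_polygon P"
    and SC: "has_polygon_SC P (0, cyclic (replicate k (quotient_singularity R 1 1)))"
    by blast
  have R: "R > 0" using assms(2) by simp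
  have poly: "polytope P" "0 \<in> P"
    using P interior_subset unfolding fano_polygon_def by auto
  obtain vs where "vs \<noteq> []" and vs: "\<And>i. i < length vs \<Longrightarrow>
      closed_segment (vs ! i) (vs ! (Suc i mod length vs)) edge_of P \<and>
      det2 (vs ! i) (vs ! (Suc i mod length vs)) < 0 \<and>
      lattice_cone_iso int_lattice (cone hull closed_segment (vs ! i) (vs ! (Suc i mod length vs)))
        (quotient_lattice R 1 1) quadrant"
    using polygon_edges_11[OF SC assms(1) R] by blast
  \<comment> \<open>Periodic indexing removes the wrap-around. For a triangle \<open>v 3\<close> is
    \<open>v 0\<close>, and the final estimate at \<open>v 3\<close> still applies.\<close>
  define v where "v i = vs ! (i mod length vs)" for i
  have edge: "closed_segment (v i) (v (Suc i)) edge_of P" "det2 (v i) (v (Suc i)) < 0"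
    and iso: "lattice_cone_iso int_lattice (cone hull closed_segment (v i) (v (Suc i)))
        (quotient_lattice R 1 1) quadrant" for i
    using vs[of "i mod length vs"] \<open>vs \<noteq> []\<close> by (simp_all add: v_def mod_Suc_eq)
  have ext: "v i extreme_point_of P" for i
    using edge(1)[of i] extreme_point_of_face[of "closed_segment (v i) (v (Suc i))" P "v i"]
    by (auto simp: edge_of_def extreme_point_of_segment)
  have prim: "primitive (v i)" and inP: "v i \<in> P" for i
    using ext[of i] P unfolding fano_polygon_def extreme_point_of_def by blast+
  have "\<exists>u \<in> int_lattice. v i + v (Suc i) = of_int R *\<^sub>R u \<and> \<bar>det2 (v i) (v (Suc i))\<bar> = of_int R" for i
    using cone_iso_11_edge[OF iso R prim prim] .
  then obtain u where u: "u i \<in> int_lattice" "v i + v (Suc i) = of_int R *\<^sub>R u i"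
    and "\<bar>det2 (v i) (v (Suc i))\<bar> = of_int R" for i
    by metis
  then have det: "det2 (v i) (v (Suc i)) = - of_int R" for i
    using edge(2)[of i] by (metis abs_of_neg minus_minus)
  have turn: "\<exists>b \<le> -2. v (Suc (Suc i)) = b *\<^sub>R v (Suc i) - v i" for i
  proof -
    obtain a :: int where a: "v (Suc (Suc i)) = (of_int (R * a) - 2) *\<^sub>R v (Suc i) - v i"
      using consecutive_vertices[OF R prim u(1) u(1) u(2) u(2)] det by metis
    obtain n where n: "n \<bullet> v i = 1" "n \<bullet> v (Suc i) = 1" "\<And>x. x \<in> P \<Longrightarrow> n \<bullet> x \<le> 1"
      using edge_supporting_form[OF poly edge(1)[of i]] edge(2)[of i] by (metis less_irrefl)
    \<comment> \<open>The form \<open>n\<close> of the edge from \<open>v i\<close> takes the value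
      \<open>(R a - 2) - 1\<close> at \<open>v (Suc (Suc i))\<close>, which is at most 1.\<close>
    have "of_int (R * a) \<le> (4 :: real)"
      using n(3)[OF inP[of "Suc (Suc i)"]] unfolding a by (simp add: inner_diff_right n(1,2))
    then have "R * a \<le> 4" by linarith
    \<comment> \<open>Here \<open>R \<ge> 5\<close> is decisive: \<open>a \<ge> 1\<close> would give
      \<open>R * a \<ge> 5\<close>.\<close>
    then have "a \<le> 0" using assms(2) mult_mono[of 5 R 1 a] by fastforce
    then have "R * a \<le> 0" using R by (simp add: mult_le_0_iff)
    then have "of_int (R * a) - 2 \<le> (-2 :: real)" by linarith
    then show ?thesis using a by blast
  qed
  obtain b where b: "b \<le> -2" "v 2 = b *\<^sub>R v 1 - v 0"
    using turn[of 0] by (auto simp: numeral_2_eq_2)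
  obtain b' where b': "b' \<le> -2" "v 3 = b' *\<^sub>R v 2 - v 1"
    using turn[of 1] by (auto simp: numeral_2_eq_2 numeral_3_eq_3)
  obtain n where n: "n \<bullet> v 0 = 1" "n \<bullet> v 1 = 1" "\<And>x. x \<in> P \<Longrightarrow> n \<bullet> x \<le> 1"
    using edge_supporting_form[OF poly edge(1)[of 0]] edge(2)[of 0] by (metis less_irrefl One_nat_def)
  \<comment> \<open>The values of \<open>n\<close> at \<open>v 2\<close> and \<open>v 3\<close> are
    \<open>b - 1\<close> and \<open>b' * (b - 1) - 1\<close>. Both factors of the product are
    negative, of absolute value at least 2 and 3.\<close>
  have "b' * (b - 1) - 1 \<le> 1"
    using n(3)[OF inP[of 3]] unfolding b'(2) b(2) by (simp add: inner_diff_right n(1,2) del: One_nat_def)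
  moreover have "2 * 3 \<le> (- b') * (1 - b)"
    by (rule mult_mono) (use b(1) b'(1) in auto)
  ultimately show False by (simp add: algebra_simps)
qed

end
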